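(* Let $f$ be a formal power series over $\mathbb{C}$ with $f(0)=0$, $f'(0)\ne0$, let $\phi$ be the associated umbral operator on $\mathbb{C}[x]$, i.e. $\phi x^n=\phi_n(x)=\sum_{k=0}^n \left[{n\atop k}\right]_\phi x^k$ where $e^{xf(t)}=\sum_{n\ge0}\phi_n(x)\frac{t^n}{n!}$, and let $Q=f^{-1}(D)$ be its delta operator. Then there exist shift-invariant operators $U,V$ on $\mathbb{C}[x]$ such that for all nonnegative integers $n$ \[ \phi\,\mathrm{x}^n=\sum_{k=0}^n \left[{n\atop k}\right]_\phi\, \mathrm{x}^k U^k V^n\,\phi \] if and only if $Q$ has one of the following forms, with $a,b,c\in\mathbb{C}\setminus\{0\}$: (i) $Q=aD$; (ii) $Q=a(e^{bD}-1)$; (iii) $Q=a\log(1+bD)$; (iv) $Q=a\big((1+bD)^c-1\big)$. Moreover, the possible expressions for $U$ and $V$ are: in case (i), $U=A$, $V=A^{-1}$ where $A$ is any shift-invariant invertible operator; in case (ii), $U=1$, $V=e^{-bD}$; in case (iii), $U=1+bD$, $V=1$; in case (iv), $U=1+bD$, $V=(1+bD)^{-c}$.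
   Context: $D$ is differentiation with respect to $x$ on $\mathbb{C}[x]$, $\mathrm{x}$ is the operator of multiplication by $x$, $f^{-1}$ is the compositional inverse of $f$, and for a formal power series $g$, $g(D)$ denotes the operator obtained by substituting $D$ into $g$. The coefficients $\left[{n\atop k}\right]_\phi$ are defined by $\phi x^n=\sum_{k=0}^n\left[{n\atop k}\right]_\phi x^k$. For $a\in\mathbb{C}$, the shift operator $E^a$ is defined by $E^a p(x)=p(x+a)$; a linear operator on $\mathbb{C}[x]$ is shift-invariant if it commutes with $E^a$ for all $a\in\mathbb{C}$ (equivalently, it equals $\tilde U(D)$ for some formal power series $\tilde U$).
   Formalization: In case (iv) the listed pair is proved to be a solution for every nonzero c, but to be the only one just for c ≠ 1: for c = 1, Q = abD falls under case (i), where e.g. U = V = 1 is also possible, so case (i) describes all pairs. *)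

theory Defs
  imports Complex_Main "HOL-Computational_Algebra.Computational_Algebra"
begin

definition shift :: "complex \<Rightarrow> complex poly \<Rightarrow> complex poly" where
  "shift a p = pcompose p [:a, 1:]"

lemma poly_shift: "poly (shift a p) x = poly p (x + a)"
  by (simp add: shift_def poly_pcompose add.commute)

definition shift_invariant :: "(complex poly \<Rightarrow> complex poly) \<Rightarrow> bool" where
  "shift_invariant U \<longleftrightarrow>
     Vector_Spaces.linear smult smult U \<and> (\<forall>a. U \<circ> shift a = shift a \<circ> U)"

definition mult_x :: "complex poly \<Rightarrow> complex poly" where
  "mult_x p = [:0, 1:] * p"

text \<open>The operator \<open>g(D)\<close>. Since \<open>D\<^sup>k p = 0\<close> for \<open>k > degree p\<close>, the finite sum is the
  whole series.\<close>

definition fps_op :: "complex fps \<Rightarrow> complex poly \<Rightarrow> complex poly" where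
  "fps_op g p = (\<Sum>k\<le>degree p. smult (fps_nth g k) ((pderiv ^^ k) p))"

text \<open>The series \<open>e\<^bsup>x f(t)\<^esup>\<close> in \<open>t\<close>, with coefficients in \<open>\<complex>[x]\<close>: the composition of
  \<open>e\<^bsup>x t\<^esup> = \<Sum>\<^sub>n x\<^sup>n t\<^sup>n / n!\<close> with \<open>f\<close>, whose coefficients are read as constant polynomials.
  Composition is meaningful only if \<open>f(0) = 0\<close>.\<close>

definition exp_x_fps :: "complex fps \<Rightarrow> complex poly fps" where
  "exp_x_fps f =
     Abs_fps (\<lambda>n. smult (1 / fact n) ([:0, 1:] ^ n)) oo Abs_fps (\<lambda>n. [:fps_nth f n:])"

definition umbral_poly :: "complex fps \<Rightarrow> nat \<Rightarrow> complex poly" where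
  "umbral_poly f n = smult (fact n) (fps_nth (exp_x_fps f) n)"

text \<open>The linear operator \<open>\<phi>\<close> with \<open>\<phi> x\<^sup>n = \<phi>\<^sub>n(x)\<close>.\<close>

definition umbral_op :: "complex fps \<Rightarrow> complex poly \<Rightarrow> complex poly" where
  "umbral_op f p = (\<Sum>n\<le>degree p. smult (coeff p n) (umbral_poly f n))"

definition umbral_coeff :: "complex fps \<Rightarrow> nat \<Rightarrow> nat \<Rightarrow> complex" where
  "umbral_coeff f n k = coeff (umbral_op f (monom 1 n)) k"

definition delta_op :: "complex fps \<Rightarrow> complex poly \<Rightarrow> complex poly" where
  "delta_op f = fps_op (fps_inv f)"

definition umbral_expansion ::
  "complex fps \<Rightarrow> (complex poly \<Rightarrow> complex poly) \<Rightarrow> (complex poly \<Rightarrow> complex poly) \<Rightarrow> bool" where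
  "umbral_expansion f U V \<longleftrightarrow>
     (\<forall>n. umbral_op f \<circ> (mult_x ^^ n) =
       (\<lambda>p. \<Sum>k\<le>n. smult (umbral_coeff f n k)
               (((mult_x ^^ k) \<circ> (U ^^ k) \<circ> (V ^^ n) \<circ> umbral_op f) p)))"

definition one_plus_bX :: "complex \<Rightarrow> complex fps" where
  "one_plus_bX b = 1 + fps_const b * fps_X"

text \<open>The binomial series \<open>\<Sum>\<^sub>n (c choose n) b\<^sup>n t\<^sup>n\<close> for \<open>(1 + b t)\<^sup>c\<close> with a complex exponent.\<close>

definition one_plus_bX_powr :: "complex \<Rightarrow> complex \<Rightarrow> complex fps" where
  "one_plus_bX_powr b c = fps_binomial c oo (fps_const b * fps_X)"

text \<open>The library's \<open>fps_ln c\<close> is the series of \<open>log(1 + t) / c\<close>, so \<open>c = 1\<close> is taken.\<close>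

definition log_one_plus_bX :: "complex \<Rightarrow> complex fps" where
  "log_one_plus_bX b = fps_ln 1 oo (fps_const b * fps_X)"

lemma umbral_op_monom: "umbral_op f (monom 1 n) = umbral_poly f n"
  by (simp add: umbral_op_def degree_monom_eq if_distrib[of "\<lambda>c. smult c _"] sum.delta
      cong: if_cong)

lemma umbral_op_upto:
  assumes "degree p \<le> m"
  shows "umbral_op f p = (\<Sum>n\<le>m. smult (coeff p n) (umbral_poly f n))"
  unfolding umbral_op_def using assms
  by (intro sum.mono_neutral_left) (auto simp: coeff_eq_0)

lemma umbral_op_add: "umbral_op f (p + q) = umbral_op f p + umbral_op f q"
proof -
  let ?m = "max (degree p) (degree q)"
  have "umbral_op f (p + q) = (\<Sum>n\<le>?m. smult (coeff (p + q) n) (umbral_poly f n))"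
    by (rule umbral_op_upto) (rule degree_add_le_max)
  also have "\<dots> = (\<Sum>n\<le>?m. smult (coeff p n) (umbral_poly f n))
      + (\<Sum>n\<le>?m. smult (coeff q n) (umbral_poly f n))"
    by (simp add: smult_add_left sum.distrib)
  also have "\<dots> = umbral_op f p + umbral_op f q"
    by (simp add: umbral_op_upto[of p ?m] umbral_op_upto[of q ?m])
  finally show ?thesis .
qed

lemma umbral_op_smult: "umbral_op f (smult c p) = smult c (umbral_op f p)"
proof -
  have "umbral_op f (smult c p) = (\<Sum>n\<le>degree p. smult (coeff (smult c p) n) (umbral_poly f n))"
    by (rule umbral_op_upto) (rule degree_smult_le)
  also have "\<dots> = smult c (umbral_op f p)"
  proof -
    have *: "smult c (sum g A) = (\<Sum>i\<in>A. smult c (g i))" for g :: "nat \<Rightarrow> complex poly" and A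
      by (induction A rule: infinite_finite_induct) (simp_all add: smult_add_right)
    show ?thesis by (simp add: umbral_op_def *)
  qed
  finally show ?thesis .
qed

lemma linear_umbral_op: "Vector_Spaces.linear smult smult (umbral_op f)"
  by unfold_locales
    (simp_all add: umbral_op_add umbral_op_smult smult_add_right smult_add_left)

lemma poly_umbral_poly: "poly (umbral_poly f n) x = fact n * fps_nth (fps_exp x oo f) n"
proof -
  have pw: "fps_nth (Abs_fps (\<lambda>n. [:fps_nth f n:]) ^ i) m = [:fps_nth (f ^ i) m:]" for i m
  proof (induction i arbitrary: m)
    case 0
    show ?case by (simp add: one_pCons)
  next
    case (Suc i)
    have *: "(\<Sum>j\<in>A. [:g j:]) = [:sum g A:]" for g :: "nat \<Rightarrow> complex" and A
      by (induction A rule: infinite_finite_induct) auto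
    show ?case by (simp add: fps_mult_nth Suc * mult.commute)
  qed
  have "poly (umbral_poly f n) x
      = fact n * (\<Sum>i=0..n. poly (smult (1 / fact i) ([:0, 1:] ^ i) * [:fps_nth (f ^ i) n:]) x)"
    by (simp only: umbral_poly_def exp_x_fps_def fps_compose_nth pw fps_nth_Abs_fps
        poly_smult poly_sum)
  also have "\<dots> = fact n * fps_nth (fps_exp x oo f) n"
    by (simp add: fps_compose_nth fps_exp_def mult.commute)
  finally show ?thesis .
qed

lemma fps_op_X: "fps_op fps_X = pderiv"
proof
  fix p :: "complex poly"
  show "fps_op fps_X p = pderiv p"
  proof (cases "degree p")
    case 0
    then show ?thesis by (simp add: fps_op_def pderiv_eq_0_iff)
  next
    case (Suc m)
    have "fps_op fps_X p = (\<Sum>k\<in>{1}. smult (fps_nth fps_X k) ((pderiv ^^ k) p))"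
      unfolding fps_op_def by (rule sum.mono_neutral_right) (auto simp: Suc)
    then show ?thesis by simp
  qed
qed

end

theory Submission
  imports Defs
begin

text \<open>
  A linear operator \<open>T\<close> on polynomials is determined by the series
  \<open>\<Sum>\<^sub>m (T x\<^sup>m) y\<^sup>m / m!\<close>. For \<open>T = \<phi> \<circ> x\<^sup>n\<close> this is the \<open>n\<close>-th derivative of
  \<open>E = e\<^bsup>x f(y)\<^esup>\<close>, and for \<open>T = u(D) \<circ> \<phi>\<close> it is \<open>(u \<circ> f) E\<close>. So the expansion with \<open>U = u(D)\<close>
  and \<open>V = v(D)\<close> says \<open>E\<^bsup>(n)\<^esup> = (v \<circ> f)\<^sup>n \<phi>\<^sub>n(x (u \<circ> f)) E\<close> for all \<open>n\<close>. Both sides satisfy a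
  binomial convolution recurrence in \<open>n\<close> because \<open>E' = x f' E\<close>; comparing the two recurrences reduces
  the condition to \<open>f\<^bsup>(n)\<^esup> = n! f\<^sub>n (u \<circ> f) (v \<circ> f)\<^sup>n\<close> for all \<open>n \<ge> 1\<close>.

  Now compose with \<open>q = f\<^bsup>-1\<^esup>\<close>, where \<open>Q = q(D)\<close>. The cases \<open>n = 1, 2, 3\<close> become
  \<open>f\<^sub>1 u v q' = 1\<close>, \<open>(u v)' = A v\<close> and \<open>(u v\<^sup>2)' = B v\<^sup>2\<close> for constants \<open>A\<close>, \<open>B\<close>. If \<open>f\<^sub>2 = 0\<close> then
  \<open>A = 0\<close> and \<open>q\<close> is linear. Otherwise \<open>A \<noteq> 0\<close>, so \<open>q\<close> determines \<open>v\<close> and then \<open>u\<close>; moreover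
  \<open>u' = 2 A - B\<close>, so \<open>u = 1 + b X\<close> and \<open>(1 + b X) q'' = - A q'\<close>, whose solutions are the listed
  forms. Conversely, \<open>f\<^sub>1 u v q' = 1\<close> together with \<open>u(0) = v(0) = 1\<close>, \<open>u'\<close> constant
  and \<open>v' = r v\<^sup>2 q'\<close> already gives the
  condition for every \<open>n\<close> by induction.
\<close>

subsection \<open>Shift-invariant operators as power series in the derivative\<close>

lemma fps_op_upto:
  assumes "degree p \<le> m"
  shows "fps_op g p = (\<Sum>k\<le>m. smult (fps_nth g k) ((pderiv ^^ k) p))"
  unfolding fps_op_def using assms
proof (intro sum.mono_neutral_left ballI)
  fix k assume "k \<in> {..m} - {..degree p}"
  then have "degree p < k" by simp
  then have "(pderiv ^^ k) p = 0"
    by (intro poly_eqI) (simp add: coeff_higher_pderiv coeff_eq_0)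
  then show "smult (fps_nth g k) ((pderiv ^^ k) p) = 0" by simp
qed auto

lemma fps_op_add: "fps_op g (p + q) = fps_op g p + fps_op g q"
proof -
  let ?m = "max (degree p) (degree q)"
  show ?thesis
    by (simp add: fps_op_upto[of _ ?m] degree_add_le_max higher_pderiv_add smult_add_right
        sum.distrib)
qed

lemma fps_op_smult: "fps_op g (smult c p) = smult c (fps_op g p)"
proof -
  have "fps_op g (smult c p) = (\<Sum>k\<le>degree p. [:c:] * smult (fps_nth g k) ((pderiv ^^ k) p))"
    using fps_op_upto[OF degree_smult_le[of c p], of g]
    by (simp add: higher_pderiv_smult mult.commute del: degree_smult_eq)
  then show ?thesis
    by (simp only: fps_op_def sum_distrib_left[symmetric]) simp
qed

lemma linear_fps_op: "Vector_Spaces.linear smult smult (fps_op g)"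
  by unfold_locales (simp_all add: fps_op_add fps_op_smult smult_add_right smult_add_left)

lemma linear_sum_smult:
  assumes "Vector_Spaces.linear smult smult (T :: complex poly \<Rightarrow> complex poly)"
  shows "T (\<Sum>i\<in>A. smult (c i) (p i)) = (\<Sum>i\<in>A. smult (c i) (T (p i)))"
proof -
  interpret Vector_Spaces.linear smult smult T by fact
  show ?thesis by (simp add: sum scale)
qed

lemma linear_comp:
  assumes "Vector_Spaces.linear smult smult (S :: complex poly \<Rightarrow> complex poly)"
    and "Vector_Spaces.linear smult smult (T :: complex poly \<Rightarrow> complex poly)"
  shows "Vector_Spaces.linear smult smult (S \<circ> T)"
  using assms by (rule Vector_Spaces.linear_compose[rotated])

text \<open>The basis x^n/n! is chosen because D lowers its index without a factor, so g(D) acts by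
  plain convolution of coefficients.\<close>

abbreviation divided_power :: "nat \<Rightarrow> complex poly" where
  "divided_power n \<equiv> monom (1 / fact n) n"

lemma linear_eqI:
  assumes S: "Vector_Spaces.linear smult smult (S :: complex poly \<Rightarrow> complex poly)"
    and T: "Vector_Spaces.linear smult smult (T :: complex poly \<Rightarrow> complex poly)"
    and eq: "\<And>n. S (divided_power n) = T (divided_power n)"
  shows "S = T"
proof
  fix p :: "complex poly"
  have p: "p = (\<Sum>n\<le>degree p. smult (coeff p n * fact n) (divided_power n))"
    by (simp add: smult_monom poly_as_sum_of_monoms)
  show "S p = T p"
    by (subst (1 2) p) (simp only: linear_sum_smult[OF S] linear_sum_smult[OF T] eq)
qed

lemma fps_op_divided_power:
  "fps_op g (divided_power n) = (\<Sum>k=0..n. smult (fps_nth g k) (divided_power (n - k)))"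
proof -
  have *: "(pderiv ^^ k) (divided_power n) = divided_power (n - k)" if "k \<le> n" for k
    using that
  proof (induction k)
    case (Suc k)
    then have "n - k = Suc (n - Suc k)" by simp
    with Suc show ?case by (simp add: pderiv_monom)
  qed simp
  have "fps_op g (divided_power n) = (\<Sum>k\<le>n. smult (fps_nth g k) ((pderiv ^^ k) (divided_power n)))"
    by (rule fps_op_upto) (simp add: degree_monom_le)
  then show ?thesis by (simp add: * atMost_atLeast0)
qed

text \<open>For fixed x, the values of g(D) on the divided powers have generating series g(t)
  e^(xt). Operator identities thereby become identities of series.\<close>

lemma poly_fps_op_divided_power:
  "poly (fps_op g (divided_power n)) x = fps_nth (g * fps_exp x) n"
  by (simp add: fps_op_divided_power poly_sum fps_mult_nth poly_monom)

lemma fps_op_mult: "fps_op (g * h) = fps_op g \<circ> fps_op h"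
proof (rule linear_eqI)
  fix n
  show "fps_op (g * h) (divided_power n) = (fps_op g \<circ> fps_op h) (divided_power n)"
  proof (rule poly_ext)
    fix x
    have "poly ((fps_op g \<circ> fps_op h) (divided_power n)) x =
        (\<Sum>k=0..n. fps_nth h k * fps_nth (g * fps_exp x) (n - k))"
      by (simp add: fps_op_divided_power[of h] linear_sum_smult[OF linear_fps_op] poly_sum
          poly_fps_op_divided_power)
    also have "\<dots> = fps_nth (h * (g * fps_exp x)) n" by (simp add: fps_mult_nth)
    finally show "poly (fps_op (g * h) (divided_power n)) x =
        poly ((fps_op g \<circ> fps_op h) (divided_power n)) x"
      by (simp add: poly_fps_op_divided_power mult_ac)
  qed
qed (intro linear_fps_op linear_comp)+

lemma fps_op_1: "fps_op 1 = id"
proof (rule linear_eqI)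
  show "fps_op 1 (divided_power n) = id (divided_power n)" for n
    by (rule poly_ext) (simp add: poly_fps_op_divided_power poly_monom)
  show "Vector_Spaces.linear smult smult (id :: complex poly \<Rightarrow> complex poly)"
    by unfold_locales (simp_all add: smult_add_right smult_add_left)
qed (rule linear_fps_op)

lemma fps_op_power: "fps_op g ^^ n = fps_op (g ^ n)"
  by (induction n) (simp_all add: fps_op_1 fps_op_mult)

lemma fps_op_eq_iff: "fps_op g = fps_op h \<longleftrightarrow> g = h"
proof
  assume eq: "fps_op g = fps_op h"
  show "g = h"
  proof (rule fps_ext)
    fix n
    have "poly (fps_op g (divided_power n)) 0 = poly (fps_op h (divided_power n)) 0"
      by (simp add: eq)
    then show "fps_nth g n = fps_nth h n"
      by (simp add: poly_fps_op_divided_power)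
  qed
qed simp

lemma linear_shift: "Vector_Spaces.linear smult smult (shift a)"
  by unfold_locales (simp_all add: shift_def pcompose_add pcompose_smult smult_add_right smult_add_left)

lemma shift_divided_power:
  "shift a (divided_power n) = (\<Sum>k=0..n. smult (fps_nth (fps_exp a) k) (divided_power (n - k)))"
proof (rule poly_ext)
  fix x
  have "poly (shift a (divided_power n)) x = fps_nth (fps_exp (a + x)) n"
    by (simp add: poly_shift poly_monom add.commute)
  then show "poly (shift a (divided_power n)) x =
      poly (\<Sum>k=0..n. smult (fps_nth (fps_exp a) k) (divided_power (n - k))) x"
    by (simp add: fps_exp_add_mult fps_mult_nth poly_sum poly_monom)
qed

text \<open>Taylor's formula E^a = e^(aD): the shifts are themselves series in D, and series in D
  commute.\<close>

lemma fps_op_exp: "fps_op (fps_exp a) = shift a"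
  by (rule linear_eqI) (auto simp: linear_fps_op linear_shift shift_divided_power fps_op_divided_power)

lemma shift_invariant_fps_op: "shift_invariant (fps_op g)"
  by (simp add: shift_invariant_def linear_fps_op mult.commute flip: fps_op_exp fps_op_mult)

text \<open>A shift-invariant U is recovered from values at 0, since (U p)(x) = (E^x U p)(0) = (U
  E^x p)(0). These values on the divided powers are the coefficients of u.\<close>

lemma shift_invariant_iff: "shift_invariant U \<longleftrightarrow> (\<exists>u. U = fps_op u)"
proof
  assume U: "shift_invariant U"
  then have lin: "Vector_Spaces.linear smult smult U" by (simp add: shift_invariant_def)
  define u where "u = Abs_fps (\<lambda>n. poly (U (divided_power n)) 0)"
  have "U = fps_op u"
  proof (rule linear_eqI[OF lin linear_fps_op])
    fix n
    show "U (divided_power n) = fps_op u (divided_power n)"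
    proof (rule poly_ext)
      fix x
      have "poly (U (divided_power n)) x = poly (shift x (U (divided_power n))) 0"
        by (simp add: poly_shift)
      also have "shift x (U (divided_power n)) = U (shift x (divided_power n))"
        using U by (metis shift_invariant_def comp_apply)
      also have "poly (U (shift x (divided_power n))) 0 =
          (\<Sum>k=0..n. fps_nth (fps_exp x) k * fps_nth u (n - k))"
        by (simp only: shift_divided_power linear_sum_smult[OF lin]) (simp add: poly_sum u_def)
      also have "\<dots> = fps_nth (fps_exp x * u) n" by (simp add: fps_mult_nth)
      finally show "poly (U (divided_power n)) x = poly (fps_op u (divided_power n)) x"
        by (simp add: poly_fps_op_divided_power mult.commute)
    qed
  qed
  then show "\<exists>u. U = fps_op u" by blast
qed (auto intro: shift_invariant_fps_op)

lemma fps_op_inverse: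
  assumes "u * w = 1"
  shows "bij (fps_op u)" and "inv (fps_op u) = fps_op w"
proof -
  have *: "fps_op u \<circ> fps_op w = id" "fps_op w \<circ> fps_op u = id"
    using assms by (simp_all add: fps_op_1 mult.commute flip: fps_op_mult)
  then show "bij (fps_op u)" by (metis o_bij)
  show "inv (fps_op u) = fps_op w" using * by (metis inv_unique_comp)
qed

text \<open>With zero constant term the operator kills the constant 1.\<close>

lemma fps_op_bij_imp_unit:
  assumes "bij (fps_op u)"
  shows "fps_nth u 0 \<noteq> 0"
proof
  assume "fps_nth u 0 = 0"
  then have "fps_op u 1 = fps_op u 0" by (simp add: fps_op_def)
  with assms show False by (metis bij_is_inj injD one_neq_zero)
qed

subsection \<open>The expansion as a condition on the derivatives\<close>

lemma fps_nth_deriv_mult: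
  fixes a b :: "'a :: comm_ring_1 fps"
  shows "fps_nth_deriv n (a * b) =
    (\<Sum>i\<le>n. of_nat (n choose i) * (fps_nth_deriv i a * fps_nth_deriv (n - i) b))"
proof (induction n arbitrary: a b)
  case (Suc n)
  define X where "X i j = fps_nth_deriv i a * fps_nth_deriv j b" for i j
  \<comment> \<open>The extra term \<open>i = Suc n\<close> vanishes because
    \<open>n choose Suc n\<close> is 0; Pascal's rule then merges the two sums.\<close>
  have shift: "(\<Sum>i\<le>n. of_nat (n choose i) * X i (Suc n - i)) =
      X 0 (Suc n) + (\<Sum>i\<le>n. of_nat (n choose Suc i) * X (Suc i) (n - i))"
    using sum.atMost_Suc_shift[of "\<lambda>i. of_nat (n choose i) * X i (Suc n - i)" n]
    by (simp add: binomial_eq_0)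
  have "fps_nth_deriv (Suc n) (a * b) =
      (\<Sum>i\<le>n. of_nat (n choose i) * X i (Suc n - i)) +
      (\<Sum>i\<le>n. of_nat (n choose i) * X (Suc i) (n - i))"
    by (simp add: Suc fps_nth_deriv_add X_def Suc_diff_le)
  also have "\<dots> = X 0 (Suc n) + (\<Sum>i\<le>n. of_nat (Suc n choose Suc i) * X (Suc i) (n - i))"
    by (simp add: shift sum.distrib algebra_simps)
  also have "\<dots> = (\<Sum>i\<le>Suc n. of_nat (Suc n choose i) * X i (Suc n - i))"
    by (simp only: sum.atMost_Suc_shift) simp
  finally show ?case by (simp only: X_def)
qed simp

lemma fact_fps_nth_deriv:
  "fact m * fps_nth (fps_nth_deriv n (a :: complex fps)) m = fact (n + m) * fps_nth a (n + m)"
proof (induction n arbitrary: a)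
  case (Suc n)
  show ?case by (simp add: Suc algebra_simps)
qed simp

text \<open>The coefficients and the initial value determine the sequence. Conversely, once
  \<open>c\<close> is cancelled, \<open>a n\<close> occurs only in the term \<open>i = n\<close>,
  with factor \<open>M 0\<close>, so the coefficients can be read off one by one.\<close>

lemma binomial_convolution_eq_iff:
  fixes M N a b :: "nat \<Rightarrow> 'a :: idom"
  assumes M: "\<And>n. M (Suc n) = c * (\<Sum>i\<le>n. of_nat (n choose i) * (a i * M (n - i)))"
    and N: "\<And>n. N (Suc n) = c * (\<Sum>i\<le>n. of_nat (n choose i) * (b i * N (n - i)))"
    and init: "M 0 = N 0"
  shows "(\<And>n. a n = b n) \<Longrightarrow> M n = N n"
    and "c \<noteq> 0 \<Longrightarrow> M 0 \<noteq> 0 \<Longrightarrow> (\<And>n. M n = N n) \<Longrightarrow> a n = b n"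
proof -
  assume ab: "\<And>n. a n = b n"
  show "M n = N n"
  proof (induction n rule: less_induct)
    case (less n)
    show ?case
    proof (cases n)
      case (Suc k)
      then show ?thesis using less by (simp add: M N ab)
    qed (simp add: init)
  qed
next
  assume "c \<noteq> 0" "M 0 \<noteq> 0" and eq: "\<And>n. M n = N n"
  show "a n = b n"
  proof (induction n rule: less_induct)
    case (less n)
    have "(\<Sum>i\<le>n. of_nat (n choose i) * (a i * M (n - i))) =
        (\<Sum>i\<le>n. of_nat (n choose i) * (b i * N (n - i)))"
      using M[of n] N[of n] eq[of "Suc n"] \<open>c \<noteq> 0\<close> by simp
    then have "(\<Sum>i<n. of_nat (n choose i) * (b i * N (n - i))) + a n * M 0 =
        (\<Sum>i<n. of_nat (n choose i) * (b i * N (n - i))) + b n * M 0"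
      by (simp add: lessThan_Suc_atMost[symmetric] less eq)
    then show "a n = b n" using \<open>M 0 \<noteq> 0\<close> by simp
  qed
qed

section \<open>The series e^(x f) for a fixed complex x, and its recurrence\<close>

definition exp_comp :: "complex fps \<Rightarrow> complex \<Rightarrow> complex fps" where
  "exp_comp f x = fps_exp x oo f"

lemma exp_comp_nth_0 [simp]: "fps_nth (exp_comp f x) 0 = 1"
  by (simp add: exp_comp_def)

lemma exp_comp_deriv_Suc:
  assumes "fps_nth f 0 = 0"
  shows "fps_nth_deriv (Suc n) (exp_comp f x) = fps_const x *
    (\<Sum>i\<le>n. of_nat (n choose i) *
      (fps_nth_deriv (Suc i) f * fps_nth_deriv (n - i) (exp_comp f x)))"
proof -
  have "fps_deriv (exp_comp f x) = fps_const x * (fps_deriv f * exp_comp f x)"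
    using assms by (simp add: exp_comp_def fps_compose_deriv fps_compose_mult_distrib mult_ac)
  then have "fps_nth_deriv (Suc n) (exp_comp f x) =
      fps_const x * fps_nth_deriv n (fps_deriv f * exp_comp f x)"
    by (simp only: fps_nth_deriv.simps fps_nth_deriv_mult_const_left)
  then show ?thesis by (simp only: fps_nth_deriv_mult fps_nth_deriv.simps)
qed

lemma umbral_poly_exp_comp: "poly (umbral_poly f n) x = fact n * fps_nth (exp_comp f x) n"
  by (simp add: poly_umbral_poly exp_comp_def)

lemma umbral_poly_0: "umbral_poly f 0 = 1"
  by (rule poly_ext) (simp add: umbral_poly_exp_comp)

text \<open>This is \<open>exp_comp_deriv_Suc\<close> at t = 0, because phi_n(x) is the n-th
  derivative of e^(x f(t)) there.\<close>

lemma umbral_poly_Suc: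
  assumes "fps_nth f 0 = 0"
  shows "umbral_poly f (Suc n) = [:0, 1:] *
    (\<Sum>i\<le>n. smult (of_nat (n choose i) * (fact (Suc i) * fps_nth f (Suc i)))
       (umbral_poly f (n - i)))"
proof (rule poly_ext)
  fix x
  have *: "poly (umbral_poly f n) x = fps_nth (fps_nth_deriv n (exp_comp f x)) 0" for n
    by (simp only: umbral_poly_exp_comp fps_deriv_maclauren_0) simp
  have "poly (umbral_poly f (Suc n)) x =
      x * (\<Sum>i\<le>n. of_nat (n choose i) *
        (fps_nth (fps_nth_deriv (Suc i) f) 0 * poly (umbral_poly f (n - i)) x))"
    by (simp only: * exp_comp_deriv_Suc[OF assms] fps_mult_nth_0 fps_sum_nth fps_nth_of_nat)
      (simp add: fps_sum_nth)
  then show "poly (umbral_poly f (Suc n)) x =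
      poly ([:0, 1:] * (\<Sum>i\<le>n. smult (of_nat (n choose i) * (fact (Suc i) * fps_nth f (Suc i)))
        (umbral_poly f (n - i)))) x"
    by (simp only: fps_deriv_maclauren_0) (simp add: poly_sum algebra_simps)
qed

lemma umbral_poly_altdef:
  "umbral_poly f n = (\<Sum>l=0..n. smult (fact n * fps_nth (f ^ l) n) (divided_power l))"
  by (rule poly_ext)
    (simp add: poly_umbral_poly poly_sum poly_monom fps_compose_nth sum_distrib_left mult_ac)

lemma degree_umbral_poly: "degree (umbral_poly f n) \<le> n"
  unfolding umbral_poly_altdef
  by (rule degree_sum_le)
    (auto intro: order.trans[OF degree_smult_le] order.trans[OF degree_monom_le])

text \<open>The operator w(D) multiplies e^(xt) by w(t); substituting f for t, it multiplies e^(x f)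
  by \<open>w oo f\<close>.\<close>

lemma poly_fps_op_umbral_poly:
  assumes "fps_nth f 0 = 0"
  shows "poly (fps_op w (umbral_poly f n)) x = fact n * fps_nth ((w oo f) * exp_comp f x) n"
proof -
  have "poly (fps_op w (umbral_poly f n)) x = fact n * fps_nth ((w * fps_exp x) oo f) n"
    by (simp only: umbral_poly_altdef linear_sum_smult[OF linear_fps_op])
      (simp add: poly_sum poly_fps_op_divided_power fps_compose_nth sum_distrib_left mult_ac)
  then show ?thesis
    using assms by (simp add: exp_comp_def fps_compose_mult_distrib)
qed

section \<open>Substitution of a series into a polynomial, for phi_n(x (u o f))\<close>

definition fps_eval :: "complex poly \<Rightarrow> complex fps \<Rightarrow> complex fps" where
  "fps_eval p z = poly (map_poly fps_const p) z"

lemma fps_eval_pCons: "fps_eval (pCons a p) z = fps_const a + z * fps_eval p z"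
  by (simp add: fps_eval_def map_poly_pCons)

lemma fps_eval_0 [simp]: "fps_eval 0 z = 0"
  by (simp add: fps_eval_def)

lemma fps_eval_add: "fps_eval (p + q) z = fps_eval p z + fps_eval q z"
  by (induction p q rule: poly_induct2) (simp_all add: fps_eval_pCons algebra_simps flip: fps_const_add)

lemma fps_eval_smult: "fps_eval (smult c p) z = fps_const c * fps_eval p z"
  by (induction p) (simp_all add: fps_eval_pCons algebra_simps flip: fps_const_mult)

lemma fps_eval_sum: "fps_eval (\<Sum>i\<in>A. p i) z = (\<Sum>i\<in>A. fps_eval (p i) z)"
  by (induction A rule: infinite_finite_induct) (simp_all add: fps_eval_add)

lemma fps_eval_altdef:
  assumes "degree p \<le> m"
  shows "fps_eval p z = (\<Sum>k\<le>m. fps_const (coeff p k) * z ^ k)"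
proof -
  have "fps_eval p z = (\<Sum>k\<le>degree p. fps_const (coeff p k) * z ^ k)"
    by (simp add: fps_eval_def poly_altdef coeff_map_poly degree_map_poly)
  also have "\<dots> = (\<Sum>k\<le>m. fps_const (coeff p k) * z ^ k)"
    using assms by (intro sum.mono_neutral_left) (auto simp: coeff_eq_0)
  finally show ?thesis .
qed

lemma fps_eval_umbral_poly_Suc:
  assumes "fps_nth f 0 = 0"
  shows "fps_eval (umbral_poly f (Suc n)) z = z *
    (\<Sum>i\<le>n. of_nat (n choose i) *
      (fps_const (fact (Suc i) * fps_nth f (Suc i)) * fps_eval (umbral_poly f (n - i)) z))"
  by (simp add: umbral_poly_Suc[OF assms] fps_eval_pCons fps_eval_sum fps_eval_smult mult.assoc
      flip: fps_const_mult fps_of_nat)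

text \<open>Both sides obey the recurrence of \<open>binomial_convolution_eq_iff\<close> with factor
  x: the left with coefficients \<open>a\<close>, the right with coefficients \<open>b\<close>
  inherited from the recurrence of phi_n. So the sides agree exactly when the coefficients
  do.\<close>

lemma expansion_umbral_iff_deriv:
  fixes f \<alpha> \<beta> :: "complex fps"
  assumes f0: "fps_nth f 0 = 0"
  shows "(\<forall>n x. fps_nth_deriv n (exp_comp f x) =
            \<beta> ^ n * fps_eval (umbral_poly f n) (fps_const x * \<alpha>) * exp_comp f x) \<longleftrightarrow>
    (\<forall>n. fps_nth_deriv (Suc n) f =
            fps_const (fact (Suc n) * fps_nth f (Suc n)) * \<alpha> * \<beta> ^ Suc n)"
proof -
  define M where "M x n = fps_nth_deriv n (exp_comp f x)" for x n
  define N where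
    "N x n = \<beta> ^ n * fps_eval (umbral_poly f n) (fps_const x * \<alpha>) * exp_comp f x" for x n
  define a where "a n = fps_nth_deriv (Suc n) f" for n
  define b where "b n = fps_const (fact (Suc n) * fps_nth f (Suc n)) * \<alpha> * \<beta> ^ Suc n" for n
  have M: "M x (Suc n) = fps_const x * (\<Sum>i\<le>n. of_nat (n choose i) * (a i * M x (n - i)))" for x n
    unfolding M_def a_def by (rule exp_comp_deriv_Suc[OF f0])
  have N: "N x (Suc n) = fps_const x * (\<Sum>i\<le>n. of_nat (n choose i) * (b i * N x (n - i)))" for x n
  proof -
    have "\<beta> ^ Suc n * (\<alpha> * (of_nat (n choose i) * (c * e))) * E =
        of_nat (n choose i) * ((c * \<alpha> * \<beta> ^ Suc i) * (\<beta> ^ (n - i) * e * E))"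
      if "i \<le> n" for i c e E
    proof -
      have "\<beta> ^ Suc n = \<beta> ^ Suc i * \<beta> ^ (n - i)"
        using that by (simp flip: power_add)
      then show ?thesis by (simp only: mult_ac)
    qed
    then have "(\<Sum>i\<le>n. \<beta> ^ Suc n * (\<alpha> * (of_nat (n choose i) *
          (fps_const (fact (Suc i) * fps_nth f (Suc i)) *
           fps_eval (umbral_poly f (n - i)) (fps_const x * \<alpha>)))) * exp_comp f x) =
        (\<Sum>i\<le>n. of_nat (n choose i) * (b i * N x (n - i)))"
      by (intro sum.cong refl) (simp only: b_def N_def atMost_iff)
    moreover have "N x (Suc n) = fps_const x * (\<Sum>i\<le>n. \<beta> ^ Suc n * (\<alpha> * (of_nat (n choose i) *
          (fps_const (fact (Suc i) * fps_nth f (Suc i)) *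
           fps_eval (umbral_poly f (n - i)) (fps_const x * \<alpha>)))) * exp_comp f x)"
      unfolding N_def fps_eval_umbral_poly_Suc[OF f0]
      by (simp only: sum_distrib_left sum_distrib_right mult_ac)
    ultimately show ?thesis by simp
  qed
  have init: "M x 0 = N x 0" for x
    using fps_eval_pCons[of 1 0] by (simp add: M_def N_def umbral_poly_0 one_pCons)
  have "M 1 0 \<noteq> 0"
    by (metis M_def exp_comp_nth_0 fps_nth_deriv.simps(1) fps_zero_nth one_neq_zero)
  have "(\<forall>n x. M x n = N x n) \<longleftrightarrow> (\<forall>n. a n = b n)"
  proof (intro iffI allI)
    fix n x assume "\<forall>n. a n = b n"
    then show "M x n = N x n"
      using binomial_convolution_eq_iff(1)[of "M x", OF M N init] by blast
  next
    \<comment> \<open>Reading off coefficients requires a nonzero factor x; x = 1 is enough, as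
      \<open>a\<close> and \<open>b\<close> do not involve x.\<close>
    fix n assume "\<forall>n x. M x n = N x n"
    then show "a n = b n"
      using binomial_convolution_eq_iff(2)[of "M 1", OF M N init] \<open>M 1 0 \<noteq> 0\<close> by simp
  qed
  then show ?thesis by (simp only: M_def N_def a_def b_def)
qed

text \<open>Both sides of the expansion are linear, so comparing them on divided powers suffices. At
  a fixed x their values there are the coefficients of the two series.\<close>

lemma umbral_expansion_iff_exp_comp:
  assumes f0: "fps_nth f 0 = 0"
  shows "umbral_expansion f (fps_op u) (fps_op v) \<longleftrightarrow>
    (\<forall>n x. fps_nth_deriv n (exp_comp f x) =
      (v oo f) ^ n * fps_eval (umbral_poly f n) (fps_const x * (u oo f)) * exp_comp f x)"
    (is "_ \<longleftrightarrow> (\<forall>n x. ?D n x = ?R n x)")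
proof -
  define S where "S n = umbral_op f \<circ> (mult_x ^^ n)" for n
  define T where "T n p = (\<Sum>k\<le>n. smult (umbral_coeff f n k)
      ((mult_x ^^ k) (fps_op (u ^ k * v ^ n) (umbral_op f p))))" for n p
  have mult_x: "(mult_x ^^ k) p = monom 1 k * p" for k p
    by (induction k) (simp_all add: mult_x_def monom_Suc)
  have linS: "Vector_Spaces.linear smult smult (S n)" for n
    by unfold_locales (simp_all add: S_def mult_x smult_add_right smult_add_left distrib_left
        umbral_op_add umbral_op_smult)
  have smult_sum: "smult c (\<Sum>i\<in>A. g i) = (\<Sum>i\<in>A. smult c (g i))"
    for c and g :: "nat \<Rightarrow> complex poly" and A
    by (induction A rule: infinite_finite_induct) (simp_all add: smult_add_right)
  have linT: "Vector_Spaces.linear smult smult (T n)" for n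
    by unfold_locales (simp_all add: T_def mult_x smult_add_right smult_add_left distrib_left
        umbral_op_add umbral_op_smult fps_op_add fps_op_smult sum.distrib smult_sum mult.commute)
  have umbral: "umbral_op f (monom c m) = smult c (umbral_poly f m)" for c m
    using umbral_op_smult[of f c "monom 1 m"] by (simp add: umbral_op_monom smult_monom)
  \<comment> \<open>phi sends x^(n+m)/m! to phi_(n+m)/m!, whose value at x is the m-th coefficient
    of the n-th derivative of e^(x f).\<close>
  have S: "poly (S n (divided_power m)) x = fps_nth (?D n x) m" for n m x
    using fact_fps_nth_deriv[of m n "exp_comp f x"]
    by (simp add: S_def mult_x mult_monom umbral umbral_poly_exp_comp field_simps)
  have T: "poly (T n (divided_power m)) x = fps_nth (?R n x) m" for n m x
  proof -
    have "poly (T n (divided_power m)) x = (\<Sum>k\<le>n. umbral_coeff f n k *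
        (x ^ k * fps_nth ((u oo f) ^ k * (v oo f) ^ n * exp_comp f x) m))"
      by (simp add: T_def umbral mult_x poly_sum poly_monom fps_op_smult
          poly_fps_op_umbral_poly[OF f0] fps_compose_mult_distrib[OF f0] fps_compose_power[OF f0])
    also have "\<dots> = fps_nth (\<Sum>k\<le>n. fps_const (umbral_coeff f n k) *
        (fps_const (x ^ k) * ((u oo f) ^ k * (v oo f) ^ n * exp_comp f x))) m"
      by (simp add: fps_sum_nth)
    also have "(\<Sum>k\<le>n. fps_const (umbral_coeff f n k) *
        (fps_const (x ^ k) * ((u oo f) ^ k * (v oo f) ^ n * exp_comp f x))) = ?R n x"
      unfolding fps_eval_altdef[OF degree_umbral_poly] umbral_coeff_def umbral_op_monom
      by (simp only: sum_distrib_left sum_distrib_right power_mult_distrib fps_const_power mult_ac)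
    finally show ?thesis .
  qed
  have "umbral_expansion f (fps_op u) (fps_op v) \<longleftrightarrow> (\<forall>n. S n = T n)"
    unfolding umbral_expansion_def S_def T_def[abs_def]
    by (simp only: fps_op_power fps_op_mult comp_apply)
  also have "\<dots> \<longleftrightarrow> (\<forall>n m. S n (divided_power m) = T n (divided_power m))"
    using linear_eqI[OF linS linT] by metis
  also have "\<dots> \<longleftrightarrow> (\<forall>n m x. fps_nth (?D n x) m = fps_nth (?R n x) m)"
    unfolding S[symmetric] T[symmetric] by (metis poly_ext)
  also have "\<dots> \<longleftrightarrow> (\<forall>n x. ?D n x = ?R n x)"
    by (auto simp: fps_eq_iff)
  finally show ?thesis .
qed

lemma umbral_expansion_iff_nth_deriv:
  assumes "fps_nth f 0 = 0"
  shows "umbral_expansion f (fps_op u) (fps_op v) \<longleftrightarrow>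
    (\<forall>n. fps_nth_deriv (Suc n) f =
      fps_const (fact (Suc n) * fps_nth f (Suc n)) * (u oo f) * (v oo f) ^ Suc n)"
  unfolding umbral_expansion_iff_exp_comp[OF assms] expansion_umbral_iff_deriv[OF assms] ..

subsection \<open>The condition on the inverse series\<close>

lemma fps_const_mult_left: "fps_const c * (fps_const d * a) = fps_const (c * d) * (a :: complex fps)"
  by (simp flip: mult.assoc)

lemma fps_const_mult_eqD:
  assumes "c \<noteq> 0" "fps_const c * a = fps_const d * (b :: complex fps)"
  shows "a = fps_const (d / c) * b"
proof -
  have "fps_const (1 / c) * (fps_const c * a) = fps_const (1 / c) * (fps_const d * b)"
    by (simp only: assms)
  then show ?thesis using \<open>c \<noteq> 0\<close> by (simp add: fps_const_mult_left)
qed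

section \<open>Uniqueness for the differential equation of the listed forms\<close>

lemma fps_linear_ODE_unique:
  fixes w z :: "complex fps"
  assumes w: "one_plus_bX b * fps_deriv w = fps_const k * w"
    and z: "one_plus_bX b * fps_deriv z = fps_const k * z"
    and init: "fps_nth w 0 = fps_nth z 0"
  shows "w = z"
proof -
  \<comment> \<open>Since 1 + bX has constant term 1, comparing coefficients lets each one determine
    the next.\<close>
  have rec: "of_nat (Suc n) * fps_nth y (Suc n) = (k - b * of_nat n) * fps_nth y n"
    if "one_plus_bX b * fps_deriv y = fps_const k * y" for y n
  proof -
    have "fps_nth (fps_deriv y + fps_const b * (fps_X * fps_deriv y)) n = k * fps_nth y n"
      using that by (simp add: one_plus_bX_def algebra_simps)
    then show ?thesis by (cases n) (simp_all add: algebra_simps)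
  qed
  have "fps_nth w n = fps_nth z n" for n
  proof (induction n)
    case (Suc n)
    have "of_nat (Suc n) * fps_nth w (Suc n) = of_nat (Suc n) * fps_nth z (Suc n)"
      using rec[OF w, of n] rec[OF z, of n] Suc by simp
    then show ?case by (simp del: of_nat_Suc)
  qed (rule init)
  then show ?thesis by (rule fps_ext)
qed

text \<open>The equation is of first order in the derivative, so the first two coefficients fix the
  series. This is how q is identified with a listed form.\<close>

lemma fps_eq_if_deriv_ODE:
  fixes q r :: "complex fps"
  assumes "one_plus_bX b * fps_deriv (fps_deriv q) = fps_const k * fps_deriv q"
    and "one_plus_bX b * fps_deriv (fps_deriv r) = fps_const k * fps_deriv r"
    and "fps_nth q 0 = fps_nth r 0" and "fps_nth q 1 = fps_nth r 1"
  shows "q = r"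
proof -
  have "fps_deriv q = fps_deriv r"
    by (rule fps_linear_ODE_unique[OF assms(1,2)]) (use assms(4) in simp)
  then have "q = fps_const (fps_nth q 0 - fps_nth r 0) + r"
    by (simp only: fps_deriv_eq_iff)
  with assms(3) show ?thesis by simp
qed

section \<open>The series 1 + bX, its logarithm and its powers\<close>

lemma one_plus_bX_0 [simp]: "one_plus_bX 0 = 1"
  by (simp add: one_plus_bX_def)

lemma one_plus_bX_nth_0 [simp]: "fps_nth (one_plus_bX b) 0 = 1"
  by (simp add: one_plus_bX_def)

lemma one_plus_bX_neq_0 [simp]: "one_plus_bX b \<noteq> 0"
  by (metis one_plus_bX_nth_0 fps_zero_nth zero_neq_one)

lemma one_plus_bX_deriv [simp]: "fps_deriv (one_plus_bX b) = fps_const b"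
  by (simp add: one_plus_bX_def)

lemma one_plus_bX_compose: "(1 + fps_X) oo (fps_const b * fps_X) = one_plus_bX b"
  by (simp add: one_plus_bX_def fps_compose_add_distrib)

lemma log_one_plus_bX_nth_0 [simp]: "fps_nth (log_one_plus_bX b) 0 = 0"
  by (simp add: log_one_plus_bX_def)

lemma log_one_plus_bX_deriv: "one_plus_bX b * fps_deriv (log_one_plus_bX b) = fps_const b"
proof -
  have "(1 + fps_X) * fps_deriv (fps_ln 1) = (1 :: complex fps)"
    by (simp add: fps_ln_deriv inverse_mult_eq_1')
  then have "((1 + fps_X) oo (fps_const b * fps_X)) *
      (fps_deriv (fps_ln 1) oo (fps_const b * fps_X)) = (1 :: complex fps)"
    by (simp flip: fps_compose_mult_distrib)
  then show ?thesis
    unfolding log_one_plus_bX_def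
    by (subst fps_compose_deriv) (simp_all add: one_plus_bX_compose flip: mult.assoc)
qed

lemma one_plus_bX_powr_nth_0 [simp]: "fps_nth (one_plus_bX_powr b c) 0 = 1"
  by (simp add: one_plus_bX_powr_def)

lemma one_plus_bX_powr_deriv:
  "one_plus_bX b * fps_deriv (one_plus_bX_powr b c) = fps_const (b * c) * one_plus_bX_powr b c"
proof -
  have "(1 + fps_X) * fps_deriv (fps_binomial c) = fps_const c * fps_binomial c"
    unfolding fps_binomial_deriv by (simp add: fps_divide_unit inverse_mult_eq_1' mult_ac)
  then have "((1 + fps_X) * fps_deriv (fps_binomial c)) oo (fps_const b * fps_X) =
      (fps_const c * fps_binomial c) oo (fps_const b * fps_X)"
    by (simp only:)
  then have "one_plus_bX b * (fps_deriv (fps_binomial c) oo (fps_const b * fps_X)) =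
      fps_const c * one_plus_bX_powr b c"
    by (simp add: one_plus_bX_powr_def fps_compose_mult_distrib one_plus_bX_compose)
  moreover have "one_plus_bX b * fps_deriv (one_plus_bX_powr b c) =
      fps_const b * (one_plus_bX b * (fps_deriv (fps_binomial c) oo (fps_const b * fps_X)))"
    by (simp add: one_plus_bX_powr_def fps_compose_deriv mult_ac)
  ultimately have "one_plus_bX b * fps_deriv (one_plus_bX_powr b c) =
      fps_const b * (fps_const c * one_plus_bX_powr b c)"
    by (simp only:)
  then show ?thesis by (simp add: fps_const_mult_left)
qed

lemma one_plus_bX_powr_minus: "one_plus_bX_powr b c * one_plus_bX_powr b (- c) = 1"
  by (simp add: one_plus_bX_powr_def flip: fps_compose_mult_distrib fps_binomial_add_mult)

section \<open>Mutually inverse series f and q\<close>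

locale fps_inverse_pair =
  fixes f q :: "complex fps"
  assumes f0: "fps_nth f 0 = 0" and q0: "fps_nth q 0 = 0"
    and fq: "f oo q = fps_X" and qf: "q oo f = fps_X"
begin

definition expands :: "complex fps \<Rightarrow> complex fps \<Rightarrow> bool" where
  "expands u v \<longleftrightarrow> umbral_expansion f (fps_op u) (fps_op v)"

lemma compose_q_eq_iff: "a oo q = b oo q \<longleftrightarrow> a = b"
proof
  assume "a oo q = b oo q"
  then have "(a oo q) oo f = (b oo q) oo f" by simp
  then show "a = b"
    by (simp add: fps_compose_assoc[OF f0 q0, symmetric] qf)
qed simp

text \<open>By the chain rule, after composition with q each derivative of f yields the next by
  differentiating and dividing by q'.\<close>

lemma deriv_compose_q:
  "fps_deriv (fps_nth_deriv n f oo q) = (fps_nth_deriv (Suc n) f oo q) * fps_deriv q"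
  by (simp add: fps_compose_deriv q0 fps_nth_deriv_commute[symmetric])

lemma deriv_f_compose_q: "(fps_deriv f oo q) * fps_deriv q = 1"
  using deriv_compose_q[of 0] by (simp add: fq)

lemma deriv_q_neq_0: "fps_deriv q \<noteq> 0"
  by (metis deriv_f_compose_q mult_zero_right zero_neq_one)

lemma f1_q1: "fps_nth f 1 * fps_nth q 1 = 1"
  using arg_cong[OF deriv_f_compose_q, of "\<lambda>s. fps_nth s 0"] by simp

lemma expands_iff:
  "expands u v \<longleftrightarrow> (\<forall>n. fps_nth_deriv (Suc n) f oo q =
     fps_const (fact (Suc n) * fps_nth f (Suc n)) * u * v ^ Suc n)"
proof -
  have fps_op_compose_q: "(u oo f) oo q = u" for u
    by (simp add: fps_compose_assoc[OF q0 f0, symmetric] fq)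
  show ?thesis
    unfolding expands_def umbral_expansion_iff_nth_deriv[OF f0]
    by (subst compose_q_eq_iff[symmetric])
      (simp only: fps_compose_mult_distrib[OF q0] fps_compose_power[OF q0, symmetric]
        fps_op_compose_q fps_const_compose)
qed

text \<open>Both u'/u and v'/v are constant multiples of v q'. Hence differentiating a multiple of u
  v^(n+1) gives a multiple of u v^(n+2) q'; cancelling q' yields the induction step.\<close>

lemma expandsI:
  assumes u0: "fps_nth u 0 = 1" and v0: "fps_nth v 0 = 1"
    and 1: "fps_const (fps_nth f 1) * (u * v * fps_deriv q) = 1"
    and u': "fps_deriv u = fps_const P"
    and v': "fps_deriv v = fps_const r * (v ^ 2 * fps_deriv q)"
  shows "expands u v"
proof -
  \<comment> \<open>The induction tracks only the existence of a constant. Its value is forced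
    afterwards by constant terms, as u(0) = v(0) = 1.\<close>
  have ex: "\<exists>c. fps_nth_deriv (Suc n) f oo q = fps_const c * u * v ^ Suc n" for n
  proof (induction n)
    case 0
    have "(fps_deriv f oo q) * fps_deriv q =
        (fps_const (fps_nth f 1) * u * v ^ Suc 0) * fps_deriv q"
      unfolding deriv_f_compose_q 1[symmetric]
      by (simp only: mult_ac power_Suc power_0 mult_1_right mult_1_left)
    then show ?case using deriv_q_neq_0 by auto
  next
    case (Suc n)
    then obtain c where c: "fps_nth_deriv (Suc n) f oo q = fps_const c * u * v ^ Suc n" by blast
    \<comment> \<open>The constant P is multiplied by the expression f_1 u v q', which equals 1, to
      bring u' into the shape needed.\<close>
    have u'_eq: "fps_deriv u = fps_const (P * fps_nth f 1) * (u * v * fps_deriv q)"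
      unfolding u' fps_const_mult[symmetric] mult.assoc
      using 1 by (simp add: mult.assoc)
    have "(fps_nth_deriv (Suc (Suc n)) f oo q) * fps_deriv q =
        fps_deriv (fps_const c * u * v ^ Suc n)"
      unfolding c[symmetric] deriv_compose_q ..
    also have "\<dots> = fps_const c * (fps_deriv u * v ^ Suc n + u * (of_nat (Suc n) * fps_deriv v * v ^ n))"
      by (simp only: fps_deriv_mult fps_deriv_const fps_deriv_power') (simp add: algebra_simps)
    also have "\<dots> = fps_const c * (fps_const (P * fps_nth f 1) + of_nat (Suc n) * fps_const r) *
        u * v ^ Suc (Suc n) * fps_deriv q"
      unfolding u'_eq v' by (simp add: algebra_simps power2_eq_square del: fps_const_mult)
    finally have "fps_nth_deriv (Suc (Suc n)) f oo q =
        fps_const (c * (P * fps_nth f 1 + of_nat (Suc n) * r)) * u * v ^ Suc (Suc n)"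
      using deriv_q_neq_0
      by (simp only: mult_cancel_right fps_of_nat[symmetric] fps_const_mult fps_const_add) simp
    then show ?case by blast
  qed
  have const: "c = fact (Suc n) * fps_nth f (Suc n)"
    if "fps_nth_deriv (Suc n) f oo q = fps_const c * u * v ^ Suc n" for c n
    using arg_cong[OF that, of "\<lambda>s. fps_nth s 0"] u0 v0
    by (simp only: fps_compose_nth_0 fps_deriv_maclauren_0 fps_mult_nth_0 fps_power_zeroth)
      (simp add: algebra_simps)
  show ?thesis
    unfolding expands_iff
  proof
    fix n
    obtain c where "fps_nth_deriv (Suc n) f oo q = fps_const c * u * v ^ Suc n"
      using ex by blast
    then show "fps_nth_deriv (Suc n) f oo q =
        fps_const (fact (Suc n) * fps_nth f (Suc n)) * u * v ^ Suc n"
      using const[of n c] by blast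
  qed
qed

section \<open>Necessary conditions on u, v and q\<close>

context
  fixes u v assumes uv: "expands u v"
begin

lemma expands_deriv_1: "fps_const (fps_nth f 1) * (u * v * fps_deriv q) = 1"
  using uv[unfolded expands_iff, rule_format, of 0] deriv_f_compose_q by (simp add: mult_ac)

lemma expands_neq_0: "u \<noteq> 0" "v \<noteq> 0"
  using expands_deriv_1 by auto

text \<open>Differentiating one instance of the criterion and inserting the next gives an equation
  with a factor u v q'; multiplication by f_1 turns that factor into 1.\<close>

lemma expands_deriv_Suc:
  "fps_const (fact (Suc n) * fps_nth f (Suc n) * fps_nth f 1) * fps_deriv (u * v ^ Suc n) =
    fps_const (fact (Suc (Suc n)) * fps_nth f (Suc (Suc n))) * v ^ Suc n"
proof -
  have D: "fps_nth_deriv (Suc n) f oo q =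
      fps_const (fact (Suc n) * fps_nth f (Suc n)) * (u * v ^ Suc n)" for n
    using uv[unfolded expands_iff] by (simp only: mult.assoc)
  have "fps_const (fact (Suc n) * fps_nth f (Suc n)) * fps_deriv (u * v ^ Suc n) =
      fps_deriv (fps_nth_deriv (Suc n) f oo q)"
    by (simp only: D fps_deriv_mult_const_left)
  also have "\<dots> = fps_const (fact (Suc (Suc n)) * fps_nth f (Suc (Suc n))) *
      (u * v ^ Suc (Suc n)) * fps_deriv q"
    unfolding deriv_compose_q by (simp only: D)
  finally have "fps_const (fps_nth f 1) * (fps_const (fact (Suc n) * fps_nth f (Suc n)) *
        fps_deriv (u * v ^ Suc n)) =
      fps_const (fact (Suc (Suc n)) * fps_nth f (Suc (Suc n))) * v ^ Suc n *
        (fps_const (fps_nth f 1) * (u * v * fps_deriv q))"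
    by (simp only: power_Suc mult_ac)
  then show ?thesis
    unfolding expands_deriv_1 by (simp only: fps_const_mult[symmetric] mult_ac mult_1_left)
qed

lemma expands_deriv_uv:
  "fps_deriv (u * v) = fps_const (2 * fps_nth f 2 / fps_nth f 1 ^ 2) * v"
proof -
  have f1: "fps_nth f 1 \<noteq> 0" using f1_q1 by auto
  have "fps_const (fps_nth f 1 ^ 2) * fps_deriv (u * v) = fps_const (2 * fps_nth f 2) * v"
    using expands_deriv_Suc[of 0] by (simp add: power2_eq_square numeral_2_eq_2)
  then show ?thesis
    using f1 by (intro fps_const_mult_eqD) simp_all
qed

text \<open>Differentiate f_1 u v q' = 1, insert (u v)' = A v and cancel v.\<close>

lemma expands_deriv_deriv_q:
  "u * fps_deriv (fps_deriv q) = fps_const (- 2 * fps_nth f 2 / fps_nth f 1 ^ 2) * fps_deriv q"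
proof -
  define A where "A = 2 * fps_nth f 2 / fps_nth f 1 ^ 2"
  have f1: "fps_nth f 1 \<noteq> 0" using f1_q1 by auto
  have "fps_const (fps_nth f 1) * fps_deriv (u * v * fps_deriv q) = 0"
    using arg_cong[OF expands_deriv_1, of fps_deriv] by simp
  then have "fps_deriv (u * v) * fps_deriv q + u * v * fps_deriv (fps_deriv q) = 0"
    using f1 by (simp add: fps_deriv_mult[of "u * v"] add.commute del: fps_deriv_mult)
  then have "v * (u * fps_deriv (fps_deriv q) + fps_const A * fps_deriv q) = 0"
    unfolding expands_deriv_uv A_def[symmetric] by (simp add: algebra_simps)
  then have "u * fps_deriv (fps_deriv q) = fps_const (- A) * fps_deriv q"
    using expands_neq_0 by (simp add: eq_neg_iff_add_eq_0 flip: fps_const_neg)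
  then show ?thesis by (simp add: A_def)
qed

lemma expands_u:
  assumes f2: "fps_nth f 2 \<noteq> 0"
  shows "\<exists>b. u = one_plus_bX b"
proof -
  have f1: "fps_nth f 1 \<noteq> 0" using f1_q1 by auto
  \<comment> \<open>Constant terms for the first two derivatives give u(0) v(0) = 1 and, as f_2 is
    nonzero, u(0) v(0)^2 = 1.\<close>
  have "fps_nth f 1 = fps_nth f 1 * (fps_nth u 0 * fps_nth v 0)"
    using arg_cong[OF uv[unfolded expands_iff, rule_format, of 0], of "\<lambda>s. fps_nth s 0"]
    by (simp add: mult_ac)
  moreover have "fps_nth f 2 = fps_nth f 2 * (fps_nth u 0 * fps_nth v 0 * fps_nth v 0)"
    using arg_cong[OF uv[unfolded expands_iff, rule_format, of 1], of "\<lambda>s. fps_nth s 0"]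
    by (simp add: mult_ac numeral_2_eq_2)
  ultimately have u0: "fps_nth u 0 = 1"
    using f1 f2 by simp
  define A where "A = 2 * fps_nth f 2 / fps_nth f 1 ^ 2"
  define c where "c = 2 * fps_nth f 2 * fps_nth f 1"
  define B where "B = 6 * fps_nth f 3 / c"
  have "c \<noteq> 0" using f1 f2 by (simp add: c_def)
  have "fps_const c * fps_deriv (u * v ^ 2) = fps_const (6 * fps_nth f 3) * v ^ 2"
    using expands_deriv_Suc[of 1] by (simp add: c_def eval_nat_numeral)
  then have B: "fps_deriv (u * v ^ 2) = fps_const B * v ^ 2"
    unfolding B_def using \<open>c \<noteq> 0\<close> by (intro fps_const_mult_eqD)
  \<comment> \<open>This combination eliminates v', and both remaining derivatives are known
    multiples of powers of v.\<close>
  have "fps_deriv u * v ^ 2 = 2 * (fps_deriv (u * v) * v) - fps_deriv (u * v ^ 2)"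
    by (simp add: power2_eq_square algebra_simps)
  also have "\<dots> = fps_const (2 * A - B) * v ^ 2"
    unfolding B expands_deriv_uv A_def[symmetric]
    by (simp add: algebra_simps power2_eq_square numeral_fps_const flip: fps_const_sub fps_const_mult)
  finally have "fps_deriv u = fps_deriv (one_plus_bX (2 * A - B))"
    using expands_neq_0 by simp
  then show ?thesis
    unfolding fps_deriv_eq_iff by (auto simp: u0)
qed

end

text \<open>The product u v is fixed by f_1 u v q' = 1. Then (u v)' = A v fixes v, because the
  hypothesis on the derivative forces A to be nonzero.\<close>

lemma expands_unique:
  assumes uv: "expands u v" and st: "expands s t" and deriv: "fps_nth (fps_deriv (s * t)) 0 \<noteq> 0"
  shows "u = s" "v = t"
proof -
  have "fps_const (fps_nth f 1) * fps_deriv q * (u * v) =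
      fps_const (fps_nth f 1) * fps_deriv q * (s * t)"
    using expands_deriv_1[OF uv] expands_deriv_1[OF st] by (simp only: mult_ac)
  then have *: "u * v = s * t"
    using deriv_q_neq_0 f1_q1 by auto
  have "fps_const (2 * fps_nth f 2 / fps_nth f 1 ^ 2) \<noteq> 0"
    using deriv expands_deriv_uv[OF st] by (metis fps_zero_nth mult_zero_left)
  then show "v = t"
    using expands_deriv_uv[OF uv] expands_deriv_uv[OF st] unfolding *
    by (metis mult_left_cancel)
  then show "u = s"
    using * expands_neq_0[OF st] by simp
qed

lemma q1_neq_0: "fps_nth q 1 \<noteq> 0"
  using f1_q1 by auto

section \<open>Expansions for the four forms of q\<close>

lemma expands_linear_iff:
  assumes a: "a \<noteq> 0" and q: "q = fps_const a * fps_X"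
  shows "expands u v \<longleftrightarrow> u * v = 1"
proof
  have f1: "fps_const (fps_nth f 1) * fps_const a = 1"
    using f1_q1 by (simp add: q)
  have q': "fps_deriv q = fps_const a"
    by (simp add: q)
  have *: "fps_const (fps_nth f 1) * (u * v * fps_deriv q) = u * v"
  proof -
    have "fps_const (fps_nth f 1) * (u * v * fps_deriv q) =
        fps_const (fps_nth f 1) * fps_const a * (u * v)"
      by (simp only: q' mult_ac)
    then show ?thesis by (simp only: f1 mult_1_left)
  qed
  { assume "expands u v"
    then show "u * v = 1" using expands_deriv_1[of u v] unfolding * by blast }
  assume uv: "u * v = 1"
  have af: "fps_X = fps_const a * f"
    using qf f0 by (simp add: q fps_compose_mult_distrib)
  have f: "f = fps_const (1 / a) * fps_X"
    unfolding af using a by (simp add: fps_const_mult_left)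
  show "expands u v"
    unfolding expands_iff
  proof
    \<comment> \<open>As f is linear too, both sides vanish for n > 0, and n = 0 amounts to u v =
      1.\<close>
    fix n
    show "fps_nth_deriv (Suc n) f oo q =
        fps_const (fact (Suc n) * fps_nth f (Suc n)) * u * v ^ Suc n"
      using uv by (cases n) (simp_all add: f mult.assoc)
  qed
qed

lemma expands_exp:
  assumes "a \<noteq> 0" "b \<noteq> 0" and q: "q = fps_const a * (fps_exp b - 1)"
  shows "expands 1 (fps_exp (- b))"
\<comment> \<open>The value of \<open>r\<close> comes from v' = -b v and v q' = a b.\<close>
proof (rule expandsI[where P = 0 and r = "- 1 / a"])
  have exp: "fps_exp (- b) * fps_exp b = 1"
    by (simp flip: fps_exp_add_mult)
  have "fps_nth f 1 * (a * b) = 1"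
    using f1_q1 by (simp add: q)
  moreover have "fps_const (fps_nth f 1) * (1 * fps_exp (- b) * fps_deriv q) =
      fps_const (fps_nth f 1 * (a * b)) * (fps_exp (- b) * fps_exp b)"
    by (simp add: q mult_ac fps_const_mult_left)
  ultimately show "fps_const (fps_nth f 1) * (1 * fps_exp (- b) * fps_deriv q) = 1"
    by (simp add: exp)
  have "fps_const (- 1 / a) * (fps_exp (- b) ^ 2 * fps_deriv q) =
      fps_const (- 1 / a * (a * b)) * (fps_exp (- b) * (fps_exp (- b) * fps_exp b))"
    by (simp add: q power2_eq_square mult_ac fps_const_mult_left)
  then show "fps_deriv (fps_exp (- b)) = fps_const (- 1 / a) * (fps_exp (- b) ^ 2 * fps_deriv q)"
    using \<open>a \<noteq> 0\<close> by (simp add: exp)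
qed simp_all

lemma expands_log:
  assumes "a \<noteq> 0" "b \<noteq> 0" and q: "q = fps_const a * log_one_plus_bX b"
  shows "expands (one_plus_bX b) 1"
proof (rule expandsI[where P = b and r = 0])
  have q': "one_plus_bX b * fps_deriv q = fps_const (a * b)"
    by (simp add: q mult.left_commute[of "one_plus_bX b"] log_one_plus_bX_deriv)
  have "fps_nth q 1 = a * b"
    using arg_cong[OF q', of "\<lambda>s. fps_nth s 0"] by simp
  then show "fps_const (fps_nth f 1) * (one_plus_bX b * 1 * fps_deriv q) = 1"
    using f1_q1 by (simp add: q')
qed simp_all

lemma expands_powr:
  assumes "a \<noteq> 0" "b \<noteq> 0" "c \<noteq> 0" and q: "q = fps_const a * (one_plus_bX_powr b c - 1)"
  shows "expands (one_plus_bX b) (one_plus_bX_powr b (- c))"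
proof (rule expandsI[where P = b and r = "- 1 / a"])
  let ?u = "one_plus_bX b" and ?v = "one_plus_bX_powr b (- c)"
  have q': "?u * fps_deriv q = fps_const (a * b * c) * one_plus_bX_powr b c"
    by (simp add: q mult.left_commute[of ?u] one_plus_bX_powr_deriv fps_const_mult_left mult.assoc)
  have "fps_nth q 1 = a * b * c"
    using arg_cong[OF q', of "\<lambda>s. fps_nth s 0"] by simp
  then have f1: "fps_nth f 1 * (a * b * c) = 1"
    using f1_q1 by simp
  have vq': "?u * ?v * fps_deriv q = fps_const (a * b * c)"
  proof -
    have "?u * ?v * fps_deriv q = (?u * fps_deriv q) * ?v"
      by (simp only: mult_ac)
    also have "\<dots> = fps_const (a * b * c) * (one_plus_bX_powr b c * ?v)"
      by (simp only: q' mult.assoc)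
    finally show ?thesis by (simp add: one_plus_bX_powr_minus)
  qed
  then show "fps_const (fps_nth f 1) * (?u * ?v * fps_deriv q) = 1"
    using f1 by simp
  \<comment> \<open>The equation for v' is checked after multiplication by 1 + bX, where
    \<open>vq'\<close> applies; this nonzero factor is cancelled at the end.\<close>
  have "?u * (fps_const (- 1 / a) * (?v ^ 2 * fps_deriv q)) =
      fps_const (- 1 / a) * (?v * (?u * ?v * fps_deriv q))"
    by (simp only: power2_eq_square mult_ac)
  also have "\<dots> = fps_const (- 1 / a * (a * b * c)) * ?v"
    unfolding vq' by (simp only: mult.commute[of ?v] fps_const_mult_left)
  also have "\<dots> = ?u * fps_deriv ?v"
    using \<open>a \<noteq> 0\<close> by (simp add: one_plus_bX_powr_deriv)
  finally show "fps_deriv ?v = fps_const (- 1 / a) * (?v ^ 2 * fps_deriv q)"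
    by simp
qed simp_all

section \<open>Classification of the possible q\<close>

lemma expands_classification:
  assumes uv: "expands u v"
  shows "(\<exists>a. a \<noteq> 0 \<and> q = fps_const a * fps_X) \<or>
    (\<exists>a b. a \<noteq> 0 \<and> b \<noteq> 0 \<and> q = fps_const a * (fps_exp b - 1)) \<or>
    (\<exists>a b. a \<noteq> 0 \<and> b \<noteq> 0 \<and> q = fps_const a * log_one_plus_bX b) \<or>
    (\<exists>a b c. a \<noteq> 0 \<and> b \<noteq> 0 \<and> c \<noteq> 0 \<and> q = fps_const a * (one_plus_bX_powr b c - 1))"
proof (cases "fps_nth f 2 = 0")
  case True
  then have "u * fps_deriv (fps_deriv q) = 0"
    using expands_deriv_deriv_q[OF uv] by (simp del: fps_deriv_eq_0_iff)
  then have q'': "fps_deriv (fps_deriv q) = 0"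
    using expands_neq_0[OF uv] by (simp del: fps_deriv_eq_0_iff)
  \<comment> \<open>Here q'' = 0 is the differential equation with b = 0 and k = 0.\<close>
  have "q = fps_const (fps_nth q 1) * fps_X"
    by (rule fps_eq_if_deriv_ODE[of 0 _ 0]) (simp_all add: q'' q0 del: fps_deriv_eq_0_iff)
  then show ?thesis using q1_neq_0 by blast
next
  case False
  define A where "A = 2 * fps_nth f 2 / fps_nth f 1 ^ 2"
  obtain b where u: "u = one_plus_bX b" using expands_u[OF uv False] by blast
  have A: "A \<noteq> 0" using False f1_q1 by (auto simp: A_def)
  have q'': "one_plus_bX b * fps_deriv (fps_deriv q) = fps_const (- A) * fps_deriv q"
    using expands_deriv_deriv_q[OF uv] by (simp add: u A_def)
  note q_eqI = fps_eq_if_deriv_ODE[OF q'']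
  \<comment> \<open>Formally q' is proportional to e^(-AX) if b = 0, and to (1 + bX)^(-A/b)
    otherwise; the latter integrates to a logarithm exactly when A = b. In each case a is chosen to
    match the linear coefficient of q.\<close>
  consider "b = 0" | "b \<noteq> 0" "A = b" | "b \<noteq> 0" "A \<noteq> b" by blast
  then show ?thesis
  proof cases
    case 1
    define a where "a = - fps_nth q 1 / A"
    have "q = fps_const a * (fps_exp (- A) - 1)"
      by (rule q_eqI) (use A 1 in \<open>simp_all add: q0 a_def fps_const_mult_left\<close>)
    moreover have "a \<noteq> 0" using A q1_neq_0 by (simp add: a_def)
    ultimately show ?thesis using A by (metis neg_equal_0_iff_equal)
  next
    case 2
    define a where "a = fps_nth q 1 / b"
    note log = log_one_plus_bX_deriv[of b]
    have log'': "one_plus_bX b * fps_deriv (fps_deriv (log_one_plus_bX b)) =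
        fps_const (- b) * fps_deriv (log_one_plus_bX b)"
      using arg_cong[OF log, of fps_deriv]
      by (simp add: eq_neg_iff_add_eq_0 flip: fps_const_neg)
    have log1: "fps_nth (log_one_plus_bX b) 1 = b"
      using arg_cong[OF log, of "\<lambda>s. fps_nth s 0"] by simp
    have "q = fps_const a * log_one_plus_bX b"
      by (rule q_eqI)
        (use 2 log1 log'' in \<open>simp_all add: q0 a_def mult.left_commute[of "one_plus_bX b"]
           mult.left_commute[of "fps_const (- b)"]\<close>)
    moreover have "a \<noteq> 0" using 2 q1_neq_0 by (simp add: a_def)
    ultimately show ?thesis using 2 by blast
  next
    case 3
    \<comment> \<open>Integrating (1 + bX)^(-A/b) raises the exponent by one; A different from b
      makes c nonzero.\<close>
    define c where "c = 1 - A / b"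
    define a where "a = fps_nth q 1 / (b * c)"
    let ?p = "one_plus_bX_powr b c"
    have c: "c \<noteq> 0" "b * c - b = - A" using 3 by (simp_all add: c_def field_simps)
    note powr = one_plus_bX_powr_deriv[of b c]
    have "fps_const b * fps_deriv ?p + one_plus_bX b * fps_deriv (fps_deriv ?p) =
        fps_const (b * c) * fps_deriv ?p"
      using arg_cong[OF powr, of fps_deriv] by (simp add: add.commute)
    then have "one_plus_bX b * fps_deriv (fps_deriv ?p) = fps_const (b * c - b) * fps_deriv ?p"
      unfolding fps_const_sub[symmetric] left_diff_distrib by (simp only: eq_diff_eq add.commute)
    then have powr'': "one_plus_bX b * fps_deriv (fps_deriv ?p) = fps_const (- A) * fps_deriv ?p"
      by (simp only: c)
    have powr1: "fps_nth ?p 1 = b * c"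
      using arg_cong[OF powr, of "\<lambda>s. fps_nth s 0"] by simp
    have "q = fps_const a * (?p - 1)"
      by (rule q_eqI)
        (use 3 c powr1 powr'' in \<open>simp_all add: q0 a_def mult.left_commute[of "one_plus_bX b"]
           mult.left_commute[of "fps_const (- A)"]\<close>)
    moreover have "a \<noteq> 0" using 3 c q1_neq_0 by (simp add: a_def)
    ultimately show ?thesis using 3 c by blast
  qed
qed

lemma expansions_eq_singleton:
  assumes "expands s t" and "fps_nth (fps_deriv (s * t)) 0 \<noteq> 0"
  shows "{(U, V). shift_invariant U \<and> shift_invariant V \<and> umbral_expansion f U V} =
    {(fps_op s, fps_op t)}"
    (is "?L = ?R")
proof (intro subset_antisym subsetI)
  fix W assume "W \<in> ?L"
  then obtain u v where W: "W = (fps_op u, fps_op v)" and "expands u v"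
    unfolding shift_invariant_iff expands_def by blast
  then have "u = s" "v = t" using expands_unique assms by blast+
  with W show "W \<in> ?R" by simp
next
  fix W assume "W \<in> ?R"
  then show "W \<in> ?L"
    using assms(1) by (simp add: expands_def shift_invariant_fps_op)
qed

end

text \<open>For c = 1 the fourth form is linear, Q = a b D, and the whole family of the first form
  occurs. So the listed pair is always asserted to be a solution, but the only one just for c
  different from 1.\<close>

theorem theorem2:
  fixes f :: "complex fps"
  assumes "fps_nth f 0 = 0" and "fps_nth (fps_deriv f) 0 \<noteq> 0"
  shows
    "((\<exists>U V. shift_invariant U \<and> shift_invariant V \<and> umbral_expansion f U V) \<longleftrightarrow>
        (\<exists>a. a \<noteq> 0 \<and> delta_op f = fps_op (fps_const a * fps_X)) \<or>
        (\<exists>a b. a \<noteq> 0 \<and> b \<noteq> 0 \<and> delta_op f = fps_op (fps_const a * (fps_exp b - 1))) \<or>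
        (\<exists>a b. a \<noteq> 0 \<and> b \<noteq> 0 \<and> delta_op f = fps_op (fps_const a * log_one_plus_bX b)) \<or>
        (\<exists>a b c. a \<noteq> 0 \<and> b \<noteq> 0 \<and> c \<noteq> 0 \<and>
           delta_op f = fps_op (fps_const a * (one_plus_bX_powr b c - 1))))
     \<and> (\<forall>a. a \<noteq> 0 \<longrightarrow> delta_op f = fps_op (fps_const a * fps_X) \<longrightarrow>
          {(U, V). shift_invariant U \<and> shift_invariant V \<and> umbral_expansion f U V}
            = {(A, inv A) | A. shift_invariant A \<and> bij A})
     \<and> (\<forall>a b. a \<noteq> 0 \<longrightarrow> b \<noteq> 0 \<longrightarrow> delta_op f = fps_op (fps_const a * (fps_exp b - 1)) \<longrightarrow>
          {(U, V). shift_invariant U \<and> shift_invariant V \<and> umbral_expansion f U V}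
            = {(id, fps_op (fps_exp (- b)))})
     \<and> (\<forall>a b. a \<noteq> 0 \<longrightarrow> b \<noteq> 0 \<longrightarrow> delta_op f = fps_op (fps_const a * log_one_plus_bX b) \<longrightarrow>
          {(U, V). shift_invariant U \<and> shift_invariant V \<and> umbral_expansion f U V}
            = {(fps_op (one_plus_bX b), id)})
     \<and> (\<forall>a b c. a \<noteq> 0 \<longrightarrow> b \<noteq> 0 \<longrightarrow> c \<noteq> 0 \<longrightarrow>
          delta_op f = fps_op (fps_const a * (one_plus_bX_powr b c - 1)) \<longrightarrow>
          (fps_op (one_plus_bX b), fps_op (one_plus_bX_powr b (- c)))
            \<in> {(U, V). shift_invariant U \<and> shift_invariant V \<and> umbral_expansion f U V} \<and>
          (c \<noteq> 1 \<longrightarrow>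
            {(U, V). shift_invariant U \<and> shift_invariant V \<and> umbral_expansion f U V}
              = {(fps_op (one_plus_bX b), fps_op (one_plus_bX_powr b (- c)))}))"
    (is "(?exists \<longleftrightarrow> ?forms) \<and> ?linear \<and> ?exp \<and> ?log \<and> ?powr")
proof -
  define q where "q = fps_inv f"
  have f1: "fps_nth f 1 \<noteq> 0" using assms(2) by simp
  interpret fps_inverse_pair f q
  proof
    show "fps_nth q 0 = 0" by (simp add: q_def fps_inv_def)
    show "f oo q = fps_X" unfolding q_def by (rule fps_inv_right[OF assms(1) f1])
    show "q oo f = fps_X" unfolding q_def by (rule fps_inv[OF assms(1) f1])
  qed (rule assms(1))
  \<comment> \<open>Injectivity of substituting D turns the forms of Q into equations between
    series.\<close>
  have delta: "delta_op f = fps_op g \<longleftrightarrow> q = g" for g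
    by (simp add: delta_op_def q_def fps_op_eq_iff)
  have exists: "?exists \<longleftrightarrow> (\<exists>u v. expands u v)"
    unfolding shift_invariant_iff expands_def by blast
  have "?exists \<longleftrightarrow> ?forms"
    unfolding exists delta
  proof
    assume "\<exists>u v. expands u v"
    then show "(\<exists>a. a \<noteq> 0 \<and> q = fps_const a * fps_X) \<or>
      (\<exists>a b. a \<noteq> 0 \<and> b \<noteq> 0 \<and> q = fps_const a * (fps_exp b - 1)) \<or>
      (\<exists>a b. a \<noteq> 0 \<and> b \<noteq> 0 \<and> q = fps_const a * log_one_plus_bX b) \<or>
      (\<exists>a b c. a \<noteq> 0 \<and> b \<noteq> 0 \<and> c \<noteq> 0 \<and> q = fps_const a * (one_plus_bX_powr b c - 1))"
      using expands_classification by blast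
  next
    assume "(\<exists>a. a \<noteq> 0 \<and> q = fps_const a * fps_X) \<or>
      (\<exists>a b. a \<noteq> 0 \<and> b \<noteq> 0 \<and> q = fps_const a * (fps_exp b - 1)) \<or>
      (\<exists>a b. a \<noteq> 0 \<and> b \<noteq> 0 \<and> q = fps_const a * log_one_plus_bX b) \<or>
      (\<exists>a b c. a \<noteq> 0 \<and> b \<noteq> 0 \<and> c \<noteq> 0 \<and> q = fps_const a * (one_plus_bX_powr b c - 1))"
    then show "\<exists>u v. expands u v"
    proof (elim disjE exE conjE)
      fix a assume "a \<noteq> 0" "q = fps_const a * fps_X"
      then have "expands 1 1" by (simp add: expands_linear_iff)
      then show ?thesis by (intro exI)
    next
      fix a b assume "a \<noteq> 0" "b \<noteq> 0" "q = fps_const a * (fps_exp b - 1)"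
      then have "expands 1 (fps_exp (- b))" by (rule expands_exp)
      then show ?thesis by (intro exI)
    next
      fix a b assume "a \<noteq> 0" "b \<noteq> 0" "q = fps_const a * log_one_plus_bX b"
      then have "expands (one_plus_bX b) 1" by (rule expands_log)
      then show ?thesis by (intro exI)
    next
      fix a b c assume "a \<noteq> 0" "b \<noteq> 0" "c \<noteq> 0" "q = fps_const a * (one_plus_bX_powr b c - 1)"
      then have "expands (one_plus_bX b) (one_plus_bX_powr b (- c))" by (rule expands_powr)
      then show ?thesis by (intro exI)
    qed
  qed
  moreover have ?linear
    unfolding delta
  proof (intro allI impI)
    fix a :: complex assume a: "a \<noteq> 0" "q = fps_const a * fps_X"
    show "{(U, V). shift_invariant U \<and> shift_invariant V \<and> umbral_expansion f U V} =
        {(A, inv A) | A. shift_invariant A \<and> bij A}" (is "?L = ?R")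
    proof (intro subset_antisym subsetI)
      fix W assume "W \<in> ?L"
      then obtain u v where W: "W = (fps_op u, fps_op v)" and "expands u v"
        unfolding shift_invariant_iff expands_def by blast
      then have "u * v = 1" using expands_linear_iff[OF a] by simp
      then have "bij (fps_op u)" "W = (fps_op u, inv (fps_op u))"
        by (simp_all add: W fps_op_inverse)
      then show "W \<in> ?R" using shift_invariant_fps_op by blast
    next
      fix W assume "W \<in> ?R"
      then obtain u where W: "W = (fps_op u, inv (fps_op u))" and bij: "bij (fps_op u)"
        unfolding shift_invariant_iff by blast
      \<comment> \<open>A bijective u(D) has nonzero constant term, so the reciprocal series exists
        and represents the inverse operator.\<close>
      have unit: "u * inverse u = 1"
        using fps_op_bij_imp_unit[OF bij] by (rule inverse_mult_eq_1')
      then have "expands u (inverse u)" using expands_linear_iff[OF a] by simp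
      then show "W \<in> ?L"
        by (simp add: W fps_op_inverse[OF unit] expands_def shift_invariant_fps_op)
    qed
  qed
  moreover have ?exp
    unfolding delta
  proof (intro allI impI)
    fix a b :: complex assume "a \<noteq> 0" "b \<noteq> 0" "q = fps_const a * (fps_exp b - 1)"
    then show "{(U, V). shift_invariant U \<and> shift_invariant V \<and> umbral_expansion f U V} =
        {(id, fps_op (fps_exp (- b)))}"
      using expansions_eq_singleton[OF expands_exp] by (simp add: fps_op_1)
  qed
  moreover have ?log
    unfolding delta
  proof (intro allI impI)
    fix a b :: complex assume "a \<noteq> 0" "b \<noteq> 0" "q = fps_const a * log_one_plus_bX b"
    then show "{(U, V). shift_invariant U \<and> shift_invariant V \<and> umbral_expansion f U V} =
        {(fps_op (one_plus_bX b), id)}"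
      using expansions_eq_singleton[OF expands_log] by (simp add: fps_op_1)
  qed
  moreover have ?powr
    unfolding delta
  proof (intro allI impI conjI)
    fix a b c :: complex
    assume abc: "a \<noteq> 0" "b \<noteq> 0" "c \<noteq> 0" "q = fps_const a * (one_plus_bX_powr b c - 1)"
    let ?u = "one_plus_bX b" and ?v = "one_plus_bX_powr b (- c)"
    have uv: "expands ?u ?v" by (rule expands_powr[OF abc])
    then show "(fps_op ?u, fps_op ?v) \<in>
        {(U, V). shift_invariant U \<and> shift_invariant V \<and> umbral_expansion f U V}"
      by (simp add: expands_def shift_invariant_fps_op)
    assume "c \<noteq> 1"
    \<comment> \<open>This value is nonzero precisely because c differs from 1, which is what
      uniqueness requires.\<close>
    have "fps_nth (fps_deriv (?u * ?v)) 0 = b * (1 - c)"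
      by (simp add: one_plus_bX_powr_deriv algebra_simps del: fps_deriv_nth)
    then show "{(U, V). shift_invariant U \<and> shift_invariant V \<and> umbral_expansion f U V} =
        {(fps_op ?u, fps_op ?v)}"
      using expansions_eq_singleton[OF uv] abc \<open>c \<noteq> 1\<close> by simp
  qed
  ultimately show ?thesis by blast
qed

end
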